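(* Let $k,m,n$ be integers with $1\le m\le k+1$ and $n\ge 0$, and write $N=(k+1)n+r$ with $0\le r\le k$. Then for $c$ an indeterminate, \[ \det_{0\leq i,j \leq N-1}\big(\mathrm{Cat}_{i+j+m,k}^{(0,c)}\big)= \begin{cases} (-1)^{\binom{k+1}{2}n} \left(\frac{F_{(k+1)(n+1)}(c)}{F_{k+1}(c)}\right)^m, & \text{if } r=0,\\[6pt] (-1)^{\binom{k+1}{2}n+\binom{k-m+1}{2}} \left(\frac{F_{(k+1)(n+1)}(c)}{F_{k+1}(c)}\right)^m, & \text{if } r=k-m+1. \end{cases} \]
   Context: For a sequence $(s_k)_{k\ge 0}$, let $\mathrm{Cat}_{n,k}^{(s)}$ be the array defined for $n\ge 1$, $k\ge 0$ by $\mathrm{Cat}_{n,k}^{(s)}=\mathrm{Cat}_{n-1,k-1}^{(s)}+s_k \mathrm{Cat}_{n-1,k}^{(s)}+\mathrm{Cat}_{n-1,k+1}^{(s)}$, with boundary values $\mathrm{Cat}_{0,0}^{(s)}=1$, $\mathrm{Cat}_{0,k}^{(s)}=0$ for $k\ge 1$, and $\mathrm{Cat}_{n,k}^{(s)}=0$ for $k<0$. For $b\in\{0,1\}$ write $\mathrm{Cat}_{n,k}^{(b,c)}$ for $\mathrm{Cat}_{n,k}^{(s)}$ with $s=(b+c,c,c,c,\ldots)$, i.e. $s_0=b+c$ and $s_k=c$ for $k\ge 1$. The polynomials $F_n(x)$ are defined by $F_0(x)=0$, $F_1(x)=1$, $F_n(x)=xF_{n-1}(x)-F_{n-2}(x)$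 for $n\ge 2$. The notation $\det_{0\le i,j\le N-1}(a_{i,j})$ is the determinant of the $N\times N$ matrix $(a_{i,j})$; the empty determinant ($N=0$) is $1$. *)

theory Defs
  imports "Jordan_Normal_Form.Determinant" "HOL-Computational_Algebra.Polynomial_Factorial"
begin

text \<open>The convention \<open>Cat\<^sub>n\<^sub>,\<^sub>k = 0\<close> for \<open>k < 0\<close> is built into the
  recursion, so that the second index can be a natural number.\<close>

fun Cat :: "(nat \<Rightarrow> 'a::comm_ring_1) \<Rightarrow> nat \<Rightarrow> nat \<Rightarrow> 'a" where
  "Cat s 0 k = (if k = 0 then 1 else 0)"
| "Cat s (Suc n) k =
     (if k = 0 then 0 else Cat s n (k - 1)) + s k * Cat s n k + Cat s n (k + 1)"

definition Cat_bc :: "'a::comm_ring_1 \<Rightarrow> 'a \<Rightarrow> nat \<Rightarrow> nat \<Rightarrow> 'a" where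
  "Cat_bc b c n k = Cat (\<lambda>j. if j = 0 then b + c else c) n k"

fun F :: "nat \<Rightarrow> int poly" where
  "F 0 = 0"
| "F (Suc 0) = 1"
| "F (Suc (Suc n)) = [:0, 1:] * F (Suc n) - F n"

text \<open>The indeterminate \<open>c\<close> is the generator of the polynomial ring over the integers.
  Hence \<open>F\<^sub>n(c)\<close> is \<open>F n\<close> itself, and quotients are formed in the
  field of fractions of that ring.\<close>

abbreviation indet :: "int poly" where
  "indet \<equiv> [:0, 1:]"

end

theory Submission
  imports Defs
begin

text \<open>Put \<open>p\<^sub>j(x) = F\<^sub>j\<^sub>+\<^sub>1(x - c)\<close>. These monic polynomials are orthonormal for the linear
functional \<open>L\<close> with moments \<open>L(x\<^sup>l) = Cat\<^sub>l\<^sub>,\<^sub>0\<close>, and \<open>L(x\<^sup>l p\<^sub>k) = Cat\<^sub>l\<^sub>,\<^sub>k\<close>, because the recursion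
of the \<open>Cat\<close> array is the three-term recursion of the \<open>p\<^sub>j\<close> (lemma \<open>moment_monom_cheb\<close>). So the
determinant in question is the Hankel determinant of the functional \<open>f \<mapsto> L(q f)\<close> with
\<open>q = x\<^sup>m p\<^sub>k\<close>, of degree \<open>d = k + m\<close>. An algebraic form of Christoffel's formula (lemma
\<open>det_moment_hankel\<close>) turns it into the determinant of the coefficients of the polynomials
\<open>q, x q, \<dots>, x\<^sup>N\<^sup>-\<^sup>1 q, p\<^sub>N, \<dots>, p\<^bsub>N+d-1\<^esub>\<close>. Up to sign this is the determinant of
\<open>p\<^sub>N, \<dots>, p\<^bsub>N+d-1\<^esub>\<close> modulo \<open>q\<close> with respect to \<open>1, \<dots>, x\<^sup>d\<^sup>-\<^sup>1\<close>.

Now write \<open>A = (k + 1)(n + 1)\<close> and \<open>V\<^sub>i = F\<^sub>i(x - c)\<close>, so that \<open>q = x\<^sup>m V\<^sub>k\<^sub>+\<^sub>1\<close>. In both cases of the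
theorem the window \<open>V\<^sub>N\<^sub>+\<^sub>1, \<dots>, V\<^sub>N\<^sub>+\<^sub>d\<close> contains \<open>V\<^sub>A\<close>, a multiple \<open>V\<^sub>k\<^sub>+\<^sub>1 G\<close> of
\<open>V\<^sub>k\<^sub>+\<^sub>1\<close>: it has \<open>k\<close> members on one side of \<open>V\<^sub>A\<close> (below it if \<open>r = 0\<close>, above it if
\<open>r = k + 1 - m\<close>) and \<open>m - 1\<close> on the other. The reflection
\<open>V\<^bsub>A+j\<^esub> + V\<^bsub>A-j\<^esub> = V\<^sub>A C\<^sub>j\<close>, with \<open>C\<^sub>j\<close> monic of degree \<open>j\<close>, lets row operations replace the shorter
side by multiples of \<open>V\<^sub>A\<close>; this is where \<open>m \<le> k + 1\<close> enters. The determinant then splits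
(lemmas \<open>det_coeff_mat_block\<close> and \<open>det_reflected_family\<close>) into two factors. One is the determinant of the
longer side modulo \<open>V\<^sub>k\<^sub>+\<^sub>1\<close>, which is a sign: by reflection every block of \<open>k\<close> residues is the
reversed negative of the preceding one (lemmas \<open>cheb_cong_mod\<close> and \<open>det_cheb_remainders\<close>). The other is
the determinant of multiplication by \<open>G\<close> modulo \<open>x\<^sup>m\<close>, that is \<open>G(0)\<^sup>m\<close>, and \<open>G(0)\<close> is the
quotient \<open>F\<^sub>A(-c) / F\<^sub>k\<^sub>+\<^sub>1(-c)\<close>, which equals \<open>F\<^sub>A(c) / F\<^sub>k\<^sub>+\<^sub>1(c)\<close> up to sign.\<close>

section \<open>The polynomials \<open>F\<^sub>n\<close> at an arbitrary ring element\<close>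

text \<open>The value of \<open>F\<^sub>n\<close> at \<open>y\<close>, in other words the rescaled Chebyshev polynomial of the second kind
\<open>U\<^sub>n\<^sub>-\<^sub>1(y / 2)\<close>. It is needed at \<open>y = x - c\<close>, at the constants \<open>c\<close> and \<open>-c\<close>, and at
\<open>y = F\<^sub>k\<^sub>+\<^sub>2 - F\<^sub>k\<close> itself, hence the arbitrary ring.\<close>
fun cheb :: "'a::comm_ring_1 \<Rightarrow> nat \<Rightarrow> 'a" where
  "cheb y 0 = 0"
| "cheb y (Suc 0) = 1"
| "cheb y (Suc (Suc n)) = y * cheb y (Suc n) - cheb y n"

lemma F_eq_cheb: "F n = cheb indet n"
  by (induction n rule: F.induct) auto

lemma poly_cheb: "poly (cheb p n) x = cheb (poly p x) n"
  by (induction n rule: F.induct) auto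

lemma cheb_neg_one_power_mult:
  "cheb ((-1) ^ e * y) (Suc n) = (-1) ^ (e * n) * cheb y (Suc n)"
proof (induction n rule: F.induct)
  case (3 n)
  have "(-1::'a) ^ e * (-1) ^ e = 1" by (simp flip: power_add)
  then have "(-1) ^ e * y * cheb ((-1) ^ e * y) (Suc (Suc n)) - cheb ((-1) ^ e * y) (Suc n)
    = (-1) ^ (e * Suc (Suc n)) * (y * cheb y (Suc (Suc n)) - cheb y (Suc n))"
    unfolding 3 by (simp add: power_add algebra_simps)
  then show ?case by simp
qed auto

lemma cheb_minus: "cheb (- y) (Suc n) = (-1) ^ n * cheb y (Suc n)"
  using cheb_neg_one_power_mult[of 1 y n] by simp

text \<open>With \<open>y = z + 1/z\<close> one has \<open>F\<^sub>n = (z\<^sup>n - z\<^sup>-\<^sup>n) / (z - 1/z)\<close>, and the factor on the right is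
\<open>z\<^sup>J + z\<^sup>-\<^sup>J\<close> for \<open>J = j + 1\<close>. The induction uses that both sides obey the recursion of \<open>F\<close> in \<open>J\<close>.\<close>
lemma cheb_reflect:
  assumes "j < A"
  shows "cheb y (A + Suc j) + cheb y (A - Suc j) = cheb y A * (cheb y (Suc (Suc j)) - cheb y j)"
  using assms
proof (induction j rule: F.induct)
  case 1
  then show ?case by (cases A) auto
next
  case 2
  define B where "B = A - Suc (Suc 0)"
  have B: "A = Suc (Suc B)" using 2 by (simp add: B_def)
  have 1: "cheb y (A + Suc (Suc 0)) = y * (y * cheb y A - cheb y (Suc B)) - cheb y A"
    by (simp add: B)
  have 2: "cheb y (A - Suc (Suc 0)) = y * cheb y (Suc B) - cheb y A"
    by (simp add: B)
  have 3: "cheb y (Suc (Suc (Suc 0))) - cheb y (Suc 0) = y * y - 1 - 1" by simp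
  show ?case unfolding 1 2 3 by (simp add: algebra_simps del: cheb.simps)
next
  case (3 j)
  define B where "B = A - Suc (Suc (Suc j))"
  have B: "A - Suc j = Suc (Suc B)" "A - Suc (Suc j) = Suc B"
    using 3 by (auto simp: B_def)
  have "cheb y (A + Suc (Suc (Suc j))) = y * cheb y (A + Suc (Suc j)) - cheb y (A + Suc j)"
    using cheb.simps(3)[of y "A + Suc j"] by (simp del: cheb.simps)
  moreover have "cheb y (A - Suc (Suc (Suc j))) = y * cheb y (A - Suc (Suc j)) - cheb y (A - Suc j)"
    unfolding B B_def[symmetric] by simp
  ultimately have *: "cheb y (A + Suc (Suc (Suc j))) + cheb y (A - Suc (Suc (Suc j)))
     = y * (cheb y (A + Suc (Suc j)) + cheb y (A - Suc (Suc j)))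
       - (cheb y (A + Suc j) + cheb y (A - Suc j))"
    by (simp add: algebra_simps del: cheb.simps)
  have 1: "cheb y (A + Suc (Suc j)) + cheb y (A - Suc (Suc j))
      = cheb y A * (cheb y (Suc (Suc (Suc j))) - cheb y (Suc j))"
    by (rule 3(1)) (use 3 in simp)
  have 2: "cheb y (A + Suc j) + cheb y (A - Suc j) = cheb y A * (cheb y (Suc (Suc j)) - cheb y j)"
    by (rule 3(2)) (use 3 in simp)
  show ?case unfolding * 1 2 by (simp add: algebra_simps)
qed

text \<open>The multiples of \<open>a + 1\<close> are equidistant, so by the reflection formula the values at these indices
satisfy the recursion of \<open>F\<close> again, with \<open>z\<^sup>a\<^sup>+\<^sup>1 + z\<^sup>-\<^sup>a\<^sup>-\<^sup>1\<close> in place of \<open>y = z + 1/z\<close>. This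
exhibits the quotient \<open>F\<^bsub>(a+1)l\<^esub> / F\<^bsub>a+1\<^esub>\<close> without division.\<close>
lemma cheb_mult:
  "cheb y (Suc a * l) = cheb y (Suc a) * cheb (cheb y (Suc (Suc a)) - cheb y a) l"
proof (induction l rule: F.induct)
  case (3 l)
  have "cheb y (Suc a * Suc l + Suc a) + cheb y (Suc a * Suc l - Suc a)
     = cheb y (Suc a * Suc l) * (cheb y (Suc (Suc a)) - cheb y a)"
    by (rule cheb_reflect) simp
  moreover have "Suc a * Suc l - Suc a = Suc a * l" "Suc a * Suc l + Suc a = Suc a * Suc (Suc l)"
    by simp_all
  ultimately have "cheb y (Suc a * Suc (Suc l)) = 
     cheb y (Suc a * Suc l) * (cheb y (Suc (Suc a)) - cheb y a) - cheb y (Suc a * l)"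
    by (simp add: algebra_simps del: cheb.simps)
  with 3 show ?case by (simp add: algebra_simps)
qed auto

text \<open>Modulo \<open>F\<^sub>k\<^sub>+\<^sub>1\<close> the sequence is odd under reflection at every multiple of \<open>k + 1\<close>. So moving up by
\<open>k + 1\<close> negates and reverses the \<open>k\<close> residues strictly between two multiples.\<close>
lemma cheb_cong_mod:
  assumes "j \<le> Suc k"
  shows "cheb y (Suc k) dvd cheb y (Suc k * n + j)
    - (-1) ^ n * cheb y (if even n then j else Suc k - j)"
  using assms
proof (induction n arbitrary: j)
  case (Suc n)
  let ?u = "cheb y (Suc k)" and ?A = "Suc k * Suc n"
  have dvd: "?u dvd cheb y ?A" by (simp only: cheb_mult dvd_triv_left)
  show ?case
  proof (cases j)
    case 0
    then show ?thesis using dvd by simp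
  next
    case (Suc i)
    let ?x = "(-1) ^ n * cheb y (if even n then Suc k - j else j)"
    have "cheb y (?A + j) + cheb y (?A - j) = cheb y ?A * (cheb y (Suc (Suc i)) - cheb y i)"
      unfolding Suc by (rule cheb_reflect) (use Suc Suc.prems in simp)
    then have "?u dvd cheb y (?A + j) + cheb y (?A - j)" using dvd by simp
    moreover have "?A - j = Suc k * n + (Suc k - j)" using Suc.prems by simp
    moreover have "?u dvd cheb y (Suc k * n + (Suc k - j)) - ?x"
    proof -
      have "Suc k - (Suc k - j) = j" using Suc.prems by simp
      then show ?thesis using Suc.IH[of "Suc k - j"] by (simp only: diff_le_self)
    qed
    ultimately have "?u dvd (cheb y (?A + j) + cheb y (?A - j)) - (cheb y (?A - j) - ?x)"
      by (metis dvd_diff)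
    moreover have "(cheb y (?A + j) + cheb y (?A - j)) - (cheb y (?A - j) - ?x)
      = cheb y (?A + j) - (-1) ^ Suc n * cheb y (if even (Suc n) then j else Suc k - j)"
      by simp
    ultimately show ?thesis by metis
  qed
qed simp

text \<open>The parity of \<open>F\<close> for the quotient \<open>F\<^bsub>(k+1)(n+1)\<^esub> / F\<^bsub>k+1\<^esub>\<close> in the form of \<open>cheb_mult\<close>.\<close>
lemma cheb_ratio_minus:
  "cheb (cheb (- c) (Suc (Suc k)) - cheb (- c) k) (Suc n)
    = (-1) ^ (Suc k * n) * cheb (cheb c (Suc (Suc k)) - cheb c k) (Suc n)"
proof -
  have "cheb (- c) (Suc (Suc k)) - cheb (- c) k = (-1) ^ Suc k * (cheb c (Suc (Suc k)) - cheb c k)"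
    by (cases k) (simp, simp only: cheb_minus, simp add: algebra_simps del: cheb.simps)
  then show ?thesis by (simp only: cheb_neg_one_power_mult)
qed

section \<open>Coefficient matrices of polynomial families\<close>

definition monic_of_degree :: "'a::comm_ring_1 poly \<Rightarrow> nat \<Rightarrow> bool" where
  "monic_of_degree p n \<longleftrightarrow> coeff p n = 1 \<and> (\<forall>j>n. coeff p j = 0)"

lemma coeff_shift_mult:
  fixes c :: "'a::comm_ring_1"
  shows "coeff ([:- c, 1:] * p) j = (if j = 0 then 0 else coeff p (j - 1)) - c * coeff p j"
  by (cases j) (auto simp: algebra_simps)

lemma monic_cheb: "monic_of_degree (cheb [:- c, 1:] (Suc n)) n"
proof (induction n rule: F.induct)
  case (3 n)
  then show ?case
    unfolding monic_of_degree_def cheb.simps(3)[of _ "Suc n"] coeff_diff coeff_shift_mult by auto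
qed (auto simp: monic_of_degree_def coeff_shift_mult coeff_pCons split: nat.splits)

lemma coeff_cheb_eq_0: "j \<ge> n \<Longrightarrow> coeff (cheb [:- c, 1:] n) j = 0"
  using monic_cheb[of c "n - 1"] by (cases n) (auto simp: monic_of_degree_def)

lemma monic_of_degree_monom_mult:
  "monic_of_degree p n \<Longrightarrow> monic_of_degree (monom 1 m * p) (m + n)"
  by (auto simp: monic_of_degree_def coeff_monom_mult)

text \<open>Cofactors of a monic polynomial have the expected degree. Here and below, degree bounds are stated as
vanishing coefficients, so that the bound \<open>0\<close> stands for the zero polynomial.\<close>
lemma coeff_monic_cofactor_eq_0:
  assumes u: "monic_of_degree u a" and "\<And>j. j \<ge> a + b \<Longrightarrow> coeff (u * s) j = 0" and "j \<ge> b"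
  shows "coeff s j = 0"
proof (rule ccontr)
  assume *: "coeff s j \<noteq> 0"
  have d: "degree u = a" "lead_coeff u = 1"
  proof -
    show "degree u = a"
      using u by (metis degree_le le_degree monic_of_degree_def order_antisym zero_neq_one)
    then show "lead_coeff u = 1" using u by (simp add: monic_of_degree_def)
  qed
  have "degree s \<ge> b" using * assms(3) le_degree by fastforce
  then have "coeff (u * s) (degree u + degree s) = 0" using assms(2) d by simp
  then have "lead_coeff s = 0" unfolding coeff_mult_degree_sum d(2) by simp
  then show False using * by auto
qed

definition coeff_mat :: "nat \<Rightarrow> (nat \<Rightarrow> 'a::comm_ring_1 poly) \<Rightarrow> 'a mat" where
  "coeff_mat n f = mat n n (\<lambda>(i, j). coeff (f i) j)"

lemma coeff_mat_cong: "(\<And>i. i < n \<Longrightarrow> f i = g i) \<Longrightarrow> coeff_mat n f = coeff_mat n g"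
  by (auto simp: coeff_mat_def)

lemma det_lower_unitriangular:
  assumes "\<And>i. i < n \<Longrightarrow> A i i = 1" "\<And>i j. i < j \<Longrightarrow> j < n \<Longrightarrow> A i j = 0"
  shows "det (mat n n (\<lambda>(i, j). A i j)) = 1"
proof -
  have "det (mat n n (\<lambda>(i, j). A i j)) = prod_list (diag_mat (mat n n (\<lambda>(i, j). A i j)))"
    by (rule det_lower_triangular[of n]) (use assms in auto)
  also have "\<dots> = 1" unfolding prod_list_diag_prod using assms by simp
  finally show ?thesis .
qed

lemma det_coeff_mat_monic:
  assumes "\<And>i. i < n \<Longrightarrow> monic_of_degree (f i) i"
  shows "det (coeff_mat n f) = 1"
  unfolding coeff_mat_def
  by (rule det_lower_unitriangular) (use assms in \<open>auto simp: monic_of_degree_def\<close>)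

lemma det_mat_mult:
  "det (mat n n (\<lambda>(i, j). \<Sum>l<n. A i l * B l j))
   = det (mat n n (\<lambda>(i, j). A i j)) * det (mat n n (\<lambda>(i, j). B i j))"
proof -
  have "mat n n (\<lambda>(i, j). \<Sum>l<n. A i l * B l j)
     = mat n n (\<lambda>(i, j). A i j) * mat n n (\<lambda>(i, j). B i j)"
    by (rule eq_matI) (auto simp: scalar_prod_def lessThan_atLeast0)
  then show ?thesis using det_mult[of "mat n n (\<lambda>(i, j). A i j)" n "mat n n (\<lambda>(i, j). B i j)"] by simp
qed

lemma det_coeff_mat_span:
  assumes "\<And>i. i < n \<Longrightarrow> f i = (\<Sum>l<n. smult (S i l) (g l))"
  shows "det (coeff_mat n f) = det (mat n n (\<lambda>(i, j). S i j)) * det (coeff_mat n g)"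
proof -
  have "coeff_mat n f = mat n n (\<lambda>(i, j). \<Sum>l<n. S i l * coeff (g l) j)"
    unfolding coeff_mat_def by (rule eq_matI) (auto simp: assms coeff_sum)
  then show ?thesis by (simp add: det_mat_mult coeff_mat_def)
qed

lemma det_coeff_mat_add_earlier:
  assumes "\<And>i. i < n \<Longrightarrow> f i = g i \<or> (\<exists>l<i. f i = g i + g l)"
  shows "det (coeff_mat n f) = det (coeff_mat n g)"
proof -
  have "\<exists>S. (\<forall>l. l > i \<longrightarrow> S l = 0) \<and> S i = 1 \<and> f i = (\<Sum>l<n. smult (S l) (g l))" if "i < n" for i
    using assms[OF that]
  proof
    assume "f i = g i"
    then show ?thesis using that
      by (intro exI[of _ "\<lambda>l. if l = i then 1 else 0"]) (auto simp: if_distrib[of "\<lambda>x. smult x _"] cong: if_cong)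
  next
    assume "\<exists>l<i. f i = g i + g l"
    then obtain l where l: "l < i" "f i = g i + g l" by blast
    have "(\<Sum>x<n. smult ((if x = i then 1 else 0) + (if x = l then 1 else 0)) (g x)) = g i + g l"
      using that l
      by (simp add: smult_add_left sum.distrib if_distrib[of "\<lambda>x. smult x _"] cong: if_cong)
    then show ?thesis using l
      by (intro exI[of _ "\<lambda>x. (if x = i then 1 else 0) + (if x = l then 1 else 0)"]) auto
  qed
  then obtain S where S: "\<And>i. i < n \<Longrightarrow> (\<forall>l. l > i \<longrightarrow> S i l = 0) \<and> S i i = 1 \<and> f i = (\<Sum>l<n. smult (S i l) (g l))"
    by metis
  have "det (coeff_mat n f) = det (mat n n (\<lambda>(i, j). S i j)) * det (coeff_mat n g)"
    using S by (intro det_coeff_mat_span) auto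
  also have "det (mat n n (\<lambda>(i, j). S i j)) = 1"
    using S by (intro det_lower_unitriangular) auto
  finally show ?thesis by simp
qed

lemma det_mat_block_upper:
  fixes A :: "nat \<Rightarrow> nat \<Rightarrow> 'a::idom"
  assumes "\<And>i j. a \<le> i \<Longrightarrow> i < a + b \<Longrightarrow> j < a \<Longrightarrow> A i j = 0"
  shows "det (mat (a + b) (a + b) (\<lambda>(i, j). A i j))
    = det (mat a a (\<lambda>(i, j). A i j)) * det (mat b b (\<lambda>(i, j). A (a + i) (a + j)))"
proof -
  have "mat (a + b) (a + b) (\<lambda>(i, j). A i j) =
    four_block_mat (mat a a (\<lambda>(i, j). A i j)) (mat a b (\<lambda>(i, j). A i (a + j)))
       (0\<^sub>m b a) (mat b b (\<lambda>(i, j). A (a + i) (a + j)))"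
    by (rule eq_matI) (use assms in auto)
  then show ?thesis
    by (simp add: det_four_block_mat_lower_left_zero[of _ a _ b])
qed

lemma poly_eq_sum_monom:
  fixes p :: "'a::comm_ring_1 poly"
  assumes "\<And>j. j \<ge> n \<Longrightarrow> coeff p j = 0"
  shows "p = (\<Sum>l<n. smult (coeff p l) (monom 1 l))"
  by (rule poly_eqI) (use assms not_less in \<open>auto simp: coeff_sum coeff_monom if_distrib cong: if_cong\<close>)

lemma sum_lessThan_add:
  "(\<Sum>l<a + b. f l) = (\<Sum>l<a. f l) + (\<Sum>l<b. f (a + l :: nat) :: 'a :: comm_monoid_add)"
  by (induction b) (auto simp: add.assoc)

text \<open>In the basis \<open>1, \<dots>, x\<^sup>a\<^sup>-\<^sup>1, u, x u, \<dots>, x\<^sup>b\<^sup>-\<^sup>1 u\<close>, which is unitriangular over the monomials, the family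
has a block upper triangular matrix. Thus the determinant factors into the determinant of the
residues modulo \<open>u\<close> and that of the quotients by \<open>u\<close>.\<close>
lemma det_coeff_mat_block:
  fixes u :: "'a::idom poly"
  assumes u: "monic_of_degree u a"
    and t: "\<And>i j. i < a \<Longrightarrow> j \<ge> a \<Longrightarrow> coeff (t i) j = 0"
    and s: "\<And>i j. i < a \<Longrightarrow> j \<ge> b \<Longrightarrow> coeff (s i) j = 0"
    and g: "\<And>i j. i < b \<Longrightarrow> j \<ge> b \<Longrightarrow> coeff (g i) j = 0"
  shows "det (coeff_mat (a + b) (\<lambda>i. if i < a then t i + u * s i else u * g (i - a)))
     = det (coeff_mat a t) * det (coeff_mat b g)"
proof -
  define h where "h l = (if l < a then monom 1 l else monom 1 (l - a) * u)" for l
  define S where "S i l = (if i < a then if l < a then coeff (t i) l else coeff (s i) (l - a)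
     else if l < a then 0 else coeff (g (i - a)) (l - a))" for i l
  have h: "det (coeff_mat (a + b) h) = 1"
  proof (rule det_coeff_mat_monic)
    fix i
    show "monic_of_degree (h i) i"
      using monic_of_degree_monom_mult[OF u, of "i - a"]
      by (auto simp: h_def monic_of_degree_def[of "monom 1 i"])
  qed
  have low: "(\<Sum>l<a. smult (coeff p l) (h l)) = p" if "\<And>j. j \<ge> a \<Longrightarrow> coeff p j = 0" for p
    by (subst (2) poly_eq_sum_monom[of a p]) (auto simp: h_def that)
  have high: "(\<Sum>l<b. smult (coeff p l) (h (a + l))) = u * p" if "\<And>j. j \<ge> b \<Longrightarrow> coeff p j = 0" for p
    by (subst (2) poly_eq_sum_monom[of b p])
      (auto simp: h_def that sum_distrib_left mult.commute)
  have "det (coeff_mat (a + b) (\<lambda>i. if i < a then t i + u * s i else u * g (i - a)))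
    = det (mat (a + b) (a + b) (\<lambda>(i, j). S i j)) * det (coeff_mat (a + b) h)"
  proof (rule det_coeff_mat_span)
    fix i assume "i < a + b"
    then show "(if i < a then t i + u * s i else u * g (i - a)) = (\<Sum>l<a + b. smult (S i l) (h l))"
      unfolding sum_lessThan_add by (auto simp: S_def low high t s g)
  qed
  also have "det (mat (a + b) (a + b) (\<lambda>(i, j). S i j)) =
     det (mat a a (\<lambda>(i, j). S i j)) * det (mat b b (\<lambda>(i, j). S (a + i) (a + j)))"
    by (rule det_mat_block_upper) (auto simp: S_def)
  also have "mat a a (\<lambda>(i, j). S i j) = coeff_mat a t"
    by (auto simp: coeff_mat_def S_def)
  also have "mat b b (\<lambda>(i, j). S (a + i) (a + j)) = coeff_mat b g"
    by (auto simp: coeff_mat_def S_def)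
  finally show ?thesis by (simp add: h)
qed

lemma det_coeff_mat_move_rows_up:
  assumes "a + b \<le> n"
  shows "det (coeff_mat n f) = (-1) ^ (a * b)
    * det (coeff_mat n (\<lambda>i. f (if i < b then i + a else if i < a + b then i - b else i)))"
proof -
  have "mat n n (\<lambda>(i, j). coeff_mat n f $$ (if i < b then i + a else if i < a + b then i - b else i, j))
    = coeff_mat n (\<lambda>i. f (if i < b then i + a else if i < a + b then i - b else i))"
    unfolding coeff_mat_def by (rule eq_matI) (use assms in auto)
  then show ?thesis
    using det_swap_initial_rows[OF _ assms, of "coeff_mat n f"] by (simp add: coeff_mat_def)
qed

text \<open>Reversal is built up by moving one row after the other to the front; the row with index \<open>l\<close> passes
\<open>l\<close> rows.\<close>
lemma det_coeff_mat_reverse: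
  assumes "l \<le> n"
  shows "det (coeff_mat n f) = (-1) ^ (l choose 2)
    * det (coeff_mat n (\<lambda>i. f (if i < l then l - Suc i else i)))"
  using assms
proof (induction l)
  case (Suc l)
  define g where "g i = f (if i < l then l - Suc i else i)" for i
  have "det (coeff_mat n f) = (-1) ^ (l choose 2) * det (coeff_mat n g)"
    using Suc unfolding g_def by simp
  also have "det (coeff_mat n g) = (-1) ^ (l * 1)
    * det (coeff_mat n (\<lambda>i. g (if i < 1 then i + l else if i < l + 1 then i - 1 else i)))"
    by (rule det_coeff_mat_move_rows_up) (use Suc.prems in simp)
  also have "(\<lambda>i. g (if i < 1 then i + l else if i < l + 1 then i - 1 else i))
     = (\<lambda>i. f (if i < Suc l then Suc l - Suc i else i))"
    by (rule ext) (auto simp: g_def intro: arg_cong[of _ _ f])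
  also have "(-1::'a) ^ (l choose 2) * ((-1) ^ (l * 1) * x) = (-1) ^ (Suc l choose 2) * x" for x
    by (simp add: numeral_2_eq_2 power_add)
  finally show ?case .
qed (simp add: numeral_2_eq_2)

lemma det_coeff_mat_smult_rows:
  "det (coeff_mat n (\<lambda>i. smult a (f i))) = a ^ n * det (coeff_mat n f)"
proof -
  have "coeff_mat n (\<lambda>i. smult a (f i)) = a \<cdot>\<^sub>m coeff_mat n f"
    unfolding coeff_mat_def by (rule eq_matI) auto
  then show ?thesis by (simp add: det_smult coeff_mat_def)
qed

text \<open>Since the \<open>C i\<close> are monic of degree \<open>i\<close>, they can be traded for the powers of \<open>x\<close> by a unitriangular
change of rows. The remaining matrix is that of multiplication by \<open>G\<close> modulo \<open>x\<^sup>m\<close>, bordered by an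
identity: triangular, with the constant coefficient of \<open>G\<close> in \<open>m\<close> diagonal places.\<close>
lemma det_truncated_multiples:
  fixes G :: "'a::idom poly"
  assumes C: "\<And>i. i < m \<Longrightarrow> monic_of_degree (C i) i"
  shows "det (coeff_mat (m + N) (\<lambda>i. if i < m then G * C i else monom 1 i)) = coeff G 0 ^ m"
proof -
  define h where "h i = (if i < m then G * monom 1 i else monom 1 i)" for i
  define S where "S i l = (if i < m then coeff (C i) l else if l = i then 1 else 0)" for i l
  have S: "det (mat (m + N) (m + N) (\<lambda>(i, j). S i j)) = 1"
    by (rule det_lower_unitriangular) (use C in \<open>auto simp: S_def monic_of_degree_def\<close>)
  have "det (coeff_mat (m + N) (\<lambda>i. if i < m then G * C i else monom 1 i))
     = det (mat (m + N) (m + N) (\<lambda>(i, j). S i j)) * det (coeff_mat (m + N) h)"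
  proof (rule det_coeff_mat_span)
    fix i assume i: "i < m + N"
    show "(if i < m then G * C i else monom 1 i) = (\<Sum>l<m + N. smult (S i l) (h l))"
    proof (cases "i < m")
      case True
      have "\<And>j. j \<ge> m \<Longrightarrow> coeff (C i) j = 0"
        using C[OF True] True by (auto simp: monic_of_degree_def)
      then show ?thesis
        unfolding sum_lessThan_add
        by (subst (1) poly_eq_sum_monom[of m "C i"])
          (auto simp: True S_def h_def sum_distrib_left)
    next
      case False
      have "(\<Sum>l<m + N. smult (S i l) (h l)) = (\<Sum>l<m + N. if l = i then h i else 0)"
        by (rule sum.cong) (auto simp: S_def False)
      then show ?thesis using False i by (simp add: h_def)
    qed
  qed
  also have "det (coeff_mat (m + N) h) = coeff G 0 ^ m"
  proof -
    have "upper_triangular (coeff_mat (m + N) h)"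
      by (auto simp: upper_triangular_def coeff_mat_def h_def mult.commute[of G] coeff_monom_mult)
    then have "det (coeff_mat (m + N) h) = prod_list (diag_mat (coeff_mat (m + N) h))"
      by (rule det_upper_triangular) (auto simp: coeff_mat_def)
    also have "\<dots> = (\<Prod>i = 0..<m + N. if i < m then coeff G 0 else 1)"
      unfolding prod_list_diag_prod
      by (rule prod.cong) (auto simp: coeff_mat_def h_def mult.commute[of G] coeff_monom_mult)
    also have "\<dots> = coeff G 0 ^ m"
      by (induction N) auto
    finally show ?thesis .
  qed
  finally show ?thesis by (simp add: S)
qed

section \<open>Families symmetric about a multiple of the modulus\<close>

text \<open>The last \<open>N\<close> rows are the multiples \<open>x\<^sup>i q\<close> of \<open>q = x\<^sup>m u\<close>, and the first \<open>k + m\<close> rows form a window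
around \<open>\<phi> k\<close>, a multiple of \<open>u\<close>. Adding row \<open>k - j\<close> to row \<open>k + j\<close> makes every row from \<open>k\<close> on a
multiple of \<open>u\<close>, because the sum is \<open>\<phi> k\<close> times \<open>C j\<close>. Then the factorisations modulo \<open>u\<close> and modulo
\<open>x\<^sup>m\<close> apply. The window may be run through in either direction, which is why \<open>\<phi>\<close> is kept abstract.\<close>
lemma det_reflected_family:
  fixes u :: "'a::idom poly"
  assumes m: "1 \<le> m" "m \<le> k + 1"
    and u: "monic_of_degree u k"
    and center: "\<phi> k = u * G"
    and C0: "C 0 = 1" and C: "\<And>i. i < m \<Longrightarrow> monic_of_degree (C i) i"
    and reflect: "\<And>j. 1 \<le> j \<Longrightarrow> j < m \<Longrightarrow> \<phi> (k + j) + \<phi> (k - j) = \<phi> k * C j"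
    and t: "\<And>i. i < k \<Longrightarrow> u dvd \<phi> i - t i" "\<And>i j. i < k \<Longrightarrow> j \<ge> k \<Longrightarrow> coeff (t i) j = 0"
    and deg: "\<And>i j. i < k + m \<Longrightarrow> j \<ge> k + (m + N) \<Longrightarrow> coeff (\<phi> i) j = 0"
  shows "det (coeff_mat (k + (m + N))
       (\<lambda>i. if i < k + m then \<phi> i else monom 1 (i - (k + m)) * (monom 1 m * u)))
     = det (coeff_mat k t) * coeff G 0 ^ m"
proof -
  obtain s where s: "\<And>i. i < k \<Longrightarrow> \<phi> i = t i + u * s i"
    using t(1) unfolding dvd_def by (metis add.commute diff_add_cancel)
  define g where "g i = (if i < m then G * C i else monom 1 i)" for i
  have ug: "u * g i = (if i = 0 then \<phi> k else \<phi> (k + i) + \<phi> (k - i))" if "i < m" for i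
    using that reflect[of i] by (auto simp: g_def center C0 mult.assoc)
  have "det (coeff_mat (k + (m + N))
       (\<lambda>i. if i < k + m then \<phi> i else monom 1 (i - (k + m)) * (monom 1 m * u)))
     = det (coeff_mat (k + (m + N)) (\<lambda>i. if i < k then t i + u * s i else u * g (i - k)))"
  proof (rule det_coeff_mat_add_earlier[symmetric])
    fix i assume i: "i < k + (m + N)"
    consider "i < k" | "i = k" | "k < i" "i < k + m" | "k + m \<le> i" by linarith
    then show "(if i < k then t i + u * s i else u * g (i - k)) =
        (if i < k + m then \<phi> i else monom 1 (i - (k + m)) * (monom 1 m * u)) \<or>
       (\<exists>l<i. (if i < k then t i + u * s i else u * g (i - k)) =
        (if i < k + m then \<phi> i else monom 1 (i - (k + m)) * (monom 1 m * u)) +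
        (if l < k + m then \<phi> l else monom 1 (l - (k + m)) * (monom 1 m * u)))"
    proof cases
      case 3
      then show ?thesis using ug[of "i - k"] m
        by (intro disjI2 exI[of _ "k - (i - k)"]) auto
    next
      case 4
      then have "u * g (i - k) = monom 1 (i - (k + m)) * (monom 1 m * u)"
        by (simp add: g_def mult.commute[of u] mult.assoc[symmetric] mult_monom)
      then show ?thesis using 4 by simp
    qed (use s ug[of 0] m in auto)
  qed
  also have "\<dots> = det (coeff_mat k t) * det (coeff_mat (m + N) g)"
  proof (rule det_coeff_mat_block[OF u t(2)])
    fix i j assume "i < k" "m + N \<le> j"
    have "u * s i = \<phi> i - t i" using s[OF \<open>i < k\<close>] by simp
    then have "coeff (u * s i) l = 0" if "l \<ge> k + (m + N)" for l
      using that t(2)[of i l] deg[of i l] \<open>i < k\<close> by simp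
    then show "coeff (s i) j = 0"
      using coeff_monic_cofactor_eq_0[OF u] \<open>m + N \<le> j\<close> by blast
  next
    fix i j assume i: "i < m + N" and j: "m + N \<le> j"
    show "coeff (g i) j = 0"
    proof (cases "i < m")
      case True
      then have "coeff (u * g i) l = 0" if "l \<ge> k + (m + N)" for l
        using that deg[of k l] deg[of "k + i" l] deg[of "k - i" l] m by (auto simp: ug)
      then show ?thesis using coeff_monic_cofactor_eq_0[OF u] j by blast
    qed (use i j in \<open>auto simp: g_def\<close>)
  qed auto
  also have "det (coeff_mat (m + N) g) = coeff G 0 ^ m"
    unfolding g_def by (rule det_truncated_multiples[OF C])
  finally show ?thesis .
qed

section \<open>The moment functional and its orthogonal polynomials\<close>

definition moment :: "'a::comm_ring_1 \<Rightarrow> 'a poly \<Rightarrow> 'a" where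
  "moment c f = (\<Sum>l\<le>degree f. coeff f l * Cat (\<lambda>_. c) l 0)"

lemma moment_eq_sum:
  assumes "\<And>j. j \<ge> D \<Longrightarrow> coeff f j = 0"
  shows "moment c f = (\<Sum>l<D. coeff f l * Cat (\<lambda>_. c) l 0)"
  unfolding moment_def
  by (rule sum.mono_neutral_cong)
    (use assms not_less in \<open>auto simp: coeff_eq_0\<close>)

lemma moment_add: "moment c (f + g) = moment c f + moment c g"
proof -
  define D where "D = Suc (max (degree f) (degree g))"
  have "moment c h = (\<Sum>l<D. coeff h l * Cat (\<lambda>_. c) l 0)" if "degree h \<le> max (degree f) (degree g)" for h
    by (rule moment_eq_sum) (use that in \<open>auto simp: D_def coeff_eq_0\<close>)
  from this[of f] this[of g] this[of "f + g"] show ?thesis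
    by (simp add: degree_add_le_max sum.distrib algebra_simps)
qed

lemma moment_smult: "moment c (smult a f) = a * moment c f"
proof -
  have "moment c (smult a f) = (\<Sum>l<Suc (degree f). coeff (smult a f) l * Cat (\<lambda>_. c) l 0)"
    by (rule moment_eq_sum) (auto simp: coeff_eq_0)
  then show ?thesis by (simp add: moment_def sum_distrib_left lessThan_Suc_atMost mult.assoc)
qed

lemma moment_diff: "moment c (f - g) = moment c f - moment c g"
  using moment_add[of c "f - g" g] by simp

lemma moment_sum: "moment c (\<Sum>i\<in>I. f i) = (\<Sum>i\<in>I. moment c (f i))"
proof (cases "finite I")
  case True
  then show ?thesis by induction (auto simp: moment_add, simp add: moment_def)
qed (simp add: moment_def)

lemma moment_monom: "moment c (monom 1 l) = Cat (\<lambda>_. c) l 0"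
proof -
  have "moment c (monom 1 l) = (\<Sum>i<Suc l. coeff (monom 1 l) i * Cat (\<lambda>_. c) i 0)"
    by (rule moment_eq_sum) auto
  also have "\<dots> = (\<Sum>i<Suc l. if i = l then Cat (\<lambda>_. c) l 0 else 0)"
    by (rule sum.cong) auto
  finally show ?thesis by simp
qed

text \<open>Multiplication by \<open>x\<close> acts on the \<open>F\<^sub>k\<^sub>+\<^sub>1(x - c)\<close> as the tridiagonal matrix with \<open>c\<close> on the diagonal and
\<open>1\<close> next to it, which is the transfer matrix of the \<open>Cat\<close> array.\<close>
lemma moment_monom_cheb:
  "moment c (monom 1 l * cheb [:- c, 1:] (Suc k)) = Cat (\<lambda>_. c) l k"
proof (induction k arbitrary: l rule: F.induct)
  case 1
  then show ?case by (simp add: moment_monom)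
next
  case 2
  have "monom 1 l * cheb [:- c, 1:] (Suc (Suc 0)) = monom 1 (Suc l) - smult c (monom 1 l)"
    by (simp add: monom_Suc)
  then show ?case by (simp add: moment_diff moment_smult moment_monom)
next
  case (3 k)
  have "monom 1 l * cheb [:- c, 1:] (Suc (Suc (Suc k)))
     = monom 1 (Suc l) * cheb [:- c, 1:] (Suc (Suc k))
       - smult c (monom 1 l * cheb [:- c, 1:] (Suc (Suc k))) - monom 1 l * cheb [:- c, 1:] (Suc k)"
    unfolding cheb.simps(3)[of _ "Suc k"]
    by (simp add: monom_Suc algebra_simps del: cheb.simps)
  then show ?case by (simp add: moment_diff moment_smult 3 del: cheb.simps(3))
qed

lemma moment_mult_cheb:
  assumes "\<And>j. j \<ge> D \<Longrightarrow> coeff f j = 0"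
  shows "moment c (f * cheb [:- c, 1:] (Suc k)) = (\<Sum>l<D. coeff f l * Cat (\<lambda>_. c) l k)"
proof -
  have "f * cheb [:- c, 1:] (Suc k) = (\<Sum>l<D. smult (coeff f l) (monom 1 l * cheb [:- c, 1:] (Suc k)))"
    by (subst (1) poly_eq_sum_monom[of D f]) (auto simp: assms sum_distrib_right)
  then show ?thesis by (simp add: moment_sum moment_smult moment_monom_cheb)
qed

lemma Cat_triangular: "n < k \<Longrightarrow> Cat s n k = 0" "Cat s n n = 1"
proof -
  show *: "n < k \<Longrightarrow> Cat s n k = 0" for n k by (induction n arbitrary: k) auto
  show "Cat s n n = 1" by (induction n) (auto simp: *)
qed

lemma moment_cheb_cheb:
  "moment c (cheb [:- c, 1:] (Suc i) * cheb [:- c, 1:] (Suc j)) = (if i = j then 1 else 0)"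
proof -
  let ?p = "\<lambda>j. cheb [:- c, 1:] (Suc j)"
  have "moment c (?p i * ?p j) = (if i = j then 1 else 0)" if "i \<le> j" for i j
  proof -
    have "moment c (?p i * ?p j) = (\<Sum>l<Suc i. coeff (?p i) l * Cat (\<lambda>_. c) l j)"
      by (rule moment_mult_cheb) (auto simp: coeff_cheb_eq_0)
    also have "\<dots> = (\<Sum>l<Suc i. if l = j then 1 else 0)"
    proof (rule sum.cong)
      fix l assume "l \<in> {..<Suc i}"
      then have "l < j \<or> l = j \<and> i = j" using that by auto
      then show "coeff (?p i) l * Cat (\<lambda>_. c) l j = (if l = j then 1 else 0)"
        using monic_cheb[of c i] by (auto simp: Cat_triangular monic_of_degree_def)
    qed simp
    finally show ?thesis using that by auto
  qed
  from this[of i j] this[of j i] show ?thesis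
    by (cases "i \<le> j") (simp_all add: mult.commute)
qed

text \<open>Christoffel's formula without zeros. Multiplying the coefficient matrix on the right by the
unitriangular matrix \<open>Cat\<^sub>l\<^sub>,\<^sub>j = L(x\<^sup>l p\<^sub>j)\<close> replaces every row polynomial \<open>f\<close> by its coordinates \<open>L(f p\<^sub>j)\<close>
with respect to the orthonormal \<open>p\<^sub>j\<close>. By orthonormality the rows \<open>p\<^sub>N, \<dots>, p\<^bsub>N+d-1\<^esub>\<close> become unit vectors, and the
corner that remains is \<open>L(x\<^sup>i q p\<^sub>j)\<close>, a unitriangular column change away from the Hankel matrix
\<open>L(x\<^sup>i\<^sup>+\<^sup>j q)\<close>.\<close>
lemma det_moment_hankel:
  fixes q :: "'a::idom poly"
  assumes q: "monic_of_degree q d"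
  shows "det (mat N N (\<lambda>(i, j). moment c (monom 1 (i + j) * q)))
    = det (coeff_mat (N + d) (\<lambda>i. if i < N then monom 1 i * q else cheb [:- c, 1:] (Suc i)))"
proof -
  let ?p = "\<lambda>j. cheb [:- c, 1:] (Suc j)"
  define f where "f i = (if i < N then monom 1 i * q else ?p i)" for i
  have f0: "coeff (f i) j = 0" if "i < N + d" "j \<ge> N + d" for i j
    using that q monic_cheb[of c i]
    by (auto simp: f_def monic_of_degree_def coeff_monom_mult)
  have "det (mat (N + d) (N + d) (\<lambda>(i, j). Cat (\<lambda>_. c) i j)) = 1"
    by (rule det_lower_unitriangular) (auto simp: Cat_triangular)
  then have "det (coeff_mat (N + d) f)
     = det (mat (N + d) (N + d) (\<lambda>(i, j). \<Sum>l<N + d. coeff (f i) l * Cat (\<lambda>_. c) l j))"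
    by (simp add: det_mat_mult coeff_mat_def)
  also have "mat (N + d) (N + d) (\<lambda>(i, j). \<Sum>l<N + d. coeff (f i) l * Cat (\<lambda>_. c) l j)
    = mat (N + d) (N + d) (\<lambda>(i, j). moment c (f i * ?p j))"
    by (rule eq_matI) (auto simp: moment_mult_cheb[of "N + d", OF f0])
  also have "det \<dots> = det (mat N N (\<lambda>(i, j). moment c (f i * ?p j)))
     * det (mat d d (\<lambda>(i, j). moment c (f (N + i) * ?p (N + j))))"
    by (rule det_mat_block_upper) 
      (auto simp: f_def moment_cheb_cheb simp del: cheb.simps)
  also have "det (mat d d (\<lambda>(i, j). moment c (f (N + i) * ?p (N + j)))) = 1"
    by (rule det_lower_unitriangular)
      (auto simp: f_def moment_cheb_cheb simp del: cheb.simps)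
  also have "mat N N (\<lambda>(i, j). moment c (f i * ?p j))
     = mat N N (\<lambda>(i, j). \<Sum>l<N. moment c (monom 1 (i + l) * q) * coeff (?p j) l)"
  proof (rule eq_matI, goal_cases)
    case (1 i j)
    then have ij: "i < N" "j < N" by auto
    have shift: "monom 1 i * q * monom 1 l = monom 1 (i + l) * q" for l
    proof -
      have "monom 1 i * q * monom 1 l = monom 1 i * monom 1 l * q" by (simp only: ac_simps)
      then show ?thesis by (simp add: mult_monom)
    qed
    have "f i * ?p j = (monom 1 i * q) * (\<Sum>l<N. smult (coeff (?p j) l) (monom 1 l))"
      by (subst poly_eq_sum_monom[of N "?p j"])
        (use ij in \<open>auto simp: f_def coeff_cheb_eq_0 simp del: cheb.simps\<close>)
    also have "\<dots> = (\<Sum>l<N. smult (coeff (?p j) l) (monom 1 (i + l) * q))"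
      unfolding sum_distrib_left mult_smult_right shift ..
    finally show ?case using ij by (simp add: moment_sum moment_smult mult.commute del: cheb.simps)
  qed auto
  also have "det \<dots> = det (mat N N (\<lambda>(i, j). moment c (monom 1 (i + j) * q)))
      * det (mat N N (\<lambda>(i, j). coeff (?p j) i))"
    by (rule det_mat_mult)
  also have "mat N N (\<lambda>(i, j). coeff (?p j) i) = transpose_mat (coeff_mat N ?p)"
    by (auto simp: coeff_mat_def transpose_mat_def)
  also have "det \<dots> = 1"
    by (simp add: det_transpose[of _ N] coeff_mat_def) 
      (fold coeff_mat_def, rule det_coeff_mat_monic, rule monic_cheb)
  finally show ?thesis by (simp add: f_def)
qed

section \<open>Evaluation of the determinants\<close>

text \<open>The rows are the residues of the block of indices \<open>(k + 1)n + 1, \<dots>, (k + 1)n + k\<close> as given by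
\<open>cheb_cong_mod\<close>. For even \<open>n\<close> they are monic of degrees \<open>0, \<dots>, k - 1\<close>; for odd \<open>n\<close> reversing
and negating the \<open>k\<close> rows gives the sign, as \<open>k + binom(k, 2) = binom(k + 1, 2)\<close>.\<close>
lemma det_cheb_remainders:
  fixes c :: "'a::idom"
  shows "det (coeff_mat k (\<lambda>i. smult ((-1) ^ n) (cheb [:- c, 1:] (if even n then Suc i else k - i))))
    = (-1) ^ ((Suc k choose 2) * n)"
proof -
  let ?f = "\<lambda>i. cheb [:- c, 1:] (Suc i)"
  have 1: "det (coeff_mat k ?f) = 1"
    by (rule det_coeff_mat_monic) (rule monic_cheb)
  show ?thesis
  proof (cases "even n")
    case True
    then show ?thesis by (simp add: 1 del: cheb.simps)
  next
    case False
    let ?r = "\<lambda>i. cheb [:- c, 1:] (k - i)"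
    have "coeff_mat k (\<lambda>i. ?f (if i < k then k - Suc i else i)) = coeff_mat k ?r"
      by (rule coeff_mat_cong) (simp add: Suc_diff_Suc)
    then have "1 = (-1) ^ (k choose 2) * det (coeff_mat k ?r)"
      using det_coeff_mat_reverse[of k k ?f] 1 by simp
    then have "det (coeff_mat k ?r) = (-1) ^ (k choose 2)"
      by (metis left_minus_one_mult_self mult.right_neutral)
    then have "det (coeff_mat k (\<lambda>i. smult (-1) (?r i))) = (-1) ^ (Suc k choose 2)"
      by (simp only: det_coeff_mat_smult_rows) (simp add: numeral_2_eq_2 power_add)
    moreover have "(-1::'a) ^ ((Suc k choose 2) * n) = (-1) ^ (Suc k choose 2)"
      using False by (simp add: power_mult minus_one_power_iff)
    ultimately show ?thesis using False by simp
  qed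
qed

text \<open>Christoffel's formula for \<open>q = x\<^sup>m F\<^sub>k\<^sub>+\<^sub>1(x - c)\<close>, with the window moved in front of the multiples of
\<open>q\<close>, the order in which \<open>det_reflected_family\<close> expects the rows.\<close>
lemma det_Cat_eq_det_coeff_mat:
  fixes c :: "'a::idom"
  shows "det (mat N N (\<lambda>(i, j). Cat (\<lambda>_. c) (i + j + m) k))
    = (-1) ^ (N * (k + m)) * det (coeff_mat (k + (m + N))
       (\<lambda>i. if i < k + m then cheb [:- c, 1:] (Suc (N + i))
            else monom 1 (i - (k + m)) * (monom 1 m * cheb [:- c, 1:] (Suc k))))"
proof -
  define q where "q = monom 1 m * cheb [:- c, 1:] (Suc k)"
  let ?f = "\<lambda>i. if i < N then monom 1 i * q else cheb [:- c, 1:] (Suc i)"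
  have q: "monic_of_degree q (k + m)"
    using monic_of_degree_monom_mult[OF monic_cheb, of m c k] by (simp add: q_def add.commute)
  have "moment c (monom 1 (i + j) * q) = Cat (\<lambda>_. c) (i + j + m) k" for i j
    using moment_monom_cheb[of c "i + j + m" k]
    by (simp add: q_def mult.assoc[symmetric] mult_monom del: cheb.simps)
  then have "det (mat N N (\<lambda>(i, j). Cat (\<lambda>_. c) (i + j + m) k)) = det (coeff_mat (N + (k + m)) ?f)"
    using det_moment_hankel[OF q, of N c] by simp
  also have "\<dots> = (-1) ^ (N * (k + m)) * det (coeff_mat (N + (k + m))
      (\<lambda>i. ?f (if i < k + m then i + N else if i < N + (k + m) then i - (k + m) else i)))"
    by (rule det_coeff_mat_move_rows_up) simp
  also have "coeff_mat (N + (k + m))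
      (\<lambda>i. ?f (if i < k + m then i + N else if i < N + (k + m) then i - (k + m) else i))
     = coeff_mat (N + (k + m))
      (\<lambda>i. if i < k + m then cheb [:- c, 1:] (Suc (N + i)) else monom 1 (i - (k + m)) * q)"
    by (rule coeff_mat_cong) (auto simp: add.commute simp del: cheb.simps)
  also have "N + (k + m) = k + (m + N)" by simp
  finally show ?thesis by (simp only: q_def)
qed

text \<open>If \<open>N = (k + 1) n\<close>, the long side of the window around \<open>A\<close> comes first. If \<open>N = A - m\<close>, it comes
last, so the window is reversed; by the reflection at \<open>A\<close> the residues of the long side are then those
of the first case up to a common sign.\<close>
lemma det_Cat:
  fixes c :: "'a::idom" and k m n :: nat
  assumes m: "1 \<le> m" "m \<le> k + 1"
  defines "\<Gamma> \<equiv> cheb (cheb c (Suc (Suc k)) - cheb c k) (Suc n)"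
  shows det_Cat_full_blocks: "det (mat (Suc k * n) (Suc k * n) (\<lambda>(i, j). Cat (\<lambda>_. c) (i + j + m) k))
      = (-1) ^ ((Suc k choose 2) * n) * \<Gamma> ^ m" (is ?case0)
    and det_Cat_partial_block: "N + m = Suc k * Suc n \<Longrightarrow>
      det (mat N N (\<lambda>(i, j). Cat (\<lambda>_. c) (i + j + m) k))
      = (-1) ^ ((Suc k choose 2) * n + (Suc k - m choose 2)) * \<Gamma> ^ m"
proof -
  define A where "A = Suc k * Suc n"
  define Y where "Y = [:- c, 1:]"
  define u where "u = cheb Y (Suc k)"
  define G where "G = cheb (cheb Y (Suc (Suc k)) - cheb Y k) (Suc n)"
  define C where "C j = (if j = 0 then 1 else cheb Y (Suc j) - cheb Y (j - 1))" for j
  define t where "t i = smult ((-1) ^ n) (cheb Y (if even n then Suc i else k - i))" for i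
  have u: "monic_of_degree u k" unfolding u_def Y_def by (rule monic_cheb)
  have A: "cheb Y A = u * G" unfolding A_def u_def G_def by (rule cheb_mult)
  have G0: "coeff G 0 = (-1) ^ (Suc k * n) * \<Gamma>"
    unfolding \<Gamma>_def cheb_ratio_minus[symmetric] poly_0_coeff_0[symmetric] G_def poly_cheb
    by (simp add: poly_cheb Y_def del: cheb.simps)
  have C: "C 0 = 1" "monic_of_degree (C i) i" for i
    using monic_cheb[of c i]
    by (auto simp: C_def Y_def monic_of_degree_def coeff_cheb_eq_0 simp del: cheb.simps)
  have reflect: "cheb Y (A + j) + cheb Y (A - j) = cheb Y A * C j" if "1 \<le> j" "j < m" for j
    using cheb_reflect[of "j - 1" A Y] that m by (auto simp: C_def A_def)
  have t_deg: "coeff (t i) j = 0" if "i < k" "j \<ge> k" for i j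
    using that by (auto simp: t_def Y_def coeff_cheb_eq_0 simp del: cheb.simps)
  have det_t: "det (coeff_mat k t) = (-1) ^ ((Suc k choose 2) * n)"
    unfolding t_def Y_def by (rule det_cheb_remainders)

  show ?case0
  proof -
    define N where "N = Suc k * n"
    have AN: "A = Suc (N + k)" by (simp add: A_def N_def)
    have "det (mat N N (\<lambda>(i, j). Cat (\<lambda>_. c) (i + j + m) k))
      = (-1) ^ (N * (k + m)) * (det (coeff_mat k t) * coeff G 0 ^ m)"
      unfolding det_Cat_eq_det_coeff_mat u_def[symmetric] Y_def[symmetric]
    proof (subst det_reflected_family[OF m u _ C(1) C(2)])
      show "cheb Y (Suc (N + k)) = u * G" using A by (simp add: AN)
      show "cheb Y (Suc (N + (k + j))) + cheb Y (Suc (N + (k - j))) = cheb Y (Suc (N + k)) * C j"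
        if "1 \<le> j" "j < m" for j
      proof -
        have "A - j = Suc (N + (k - j))" "A + j = Suc (N + (k + j))" using that m by (auto simp: AN)
        then show ?thesis using reflect[OF that] by (simp only: AN)
      qed
      show "u dvd cheb Y (Suc (N + i)) - t i" if "i < k" for i
        using cheb_cong_mod[of "Suc i" k Y n] that
        by (auto simp: u_def t_def N_def minus_one_power_iff simp del: cheb.simps)
      show "coeff (cheb Y (Suc (N + i))) j = 0" if "i < k + m" "j \<ge> k + (m + N)" for i j
        unfolding Y_def by (rule coeff_cheb_eq_0) (use that in simp)
    qed (use t_deg in auto)
    also have "\<dots> = (-1) ^ (N * (k + m) + (Suc k choose 2) * n + Suc k * n * m) * \<Gamma> ^ m"
      by (simp only: det_t G0 power_mult_distrib power_mult[symmetric] power_add mult.assoc)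
    also have "(-1::'a) ^ (N * (k + m) + (Suc k choose 2) * n + Suc k * n * m)
       = (-1) ^ ((Suc k choose 2) * n)"
      by (auto simp: minus_one_power_iff N_def)
    finally show ?thesis by (simp only: N_def)
  qed

  show "det (mat N N (\<lambda>(i, j). Cat (\<lambda>_. c) (i + j + m) k))
      = (-1) ^ ((Suc k choose 2) * n + (Suc k - m choose 2)) * \<Gamma> ^ m"
    if N: "N + m = Suc k * Suc n"
  proof -
    have AN: "A = N + m" using N by (simp add: A_def)
    define \<phi> where "\<phi> i = cheb Y (A + k - i)" for i
    let ?q = "monom 1 m * u"
    let ?f = "\<lambda>i. if i < k + m then cheb Y (Suc (N + i)) else monom 1 (i - (k + m)) * ?q"
    have "det (coeff_mat (k + (m + N)) ?f) = (-1) ^ (k + m choose 2)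
      * det (coeff_mat (k + (m + N)) (\<lambda>i. ?f (if i < k + m then k + m - Suc i else i)))"
      by (rule det_coeff_mat_reverse) simp
    also have "coeff_mat (k + (m + N)) (\<lambda>i. ?f (if i < k + m then k + m - Suc i else i))
      = coeff_mat (k + (m + N)) (\<lambda>i. if i < k + m then \<phi> i else monom 1 (i - (k + m)) * ?q)"
    proof (rule coeff_mat_cong, goal_cases)
      case (1 i)
      have "Suc (N + (k + m - Suc i)) = A + k - i" if "i < k + m"
        using that by (simp add: AN)
      then show ?case by (auto simp: \<phi>_def simp del: cheb.simps)
    qed
    also have "det \<dots> = det (coeff_mat k (\<lambda>i. smult (-1) (t i))) * coeff G 0 ^ m"
    proof (rule det_reflected_family[OF m u _ C(1) C(2)])
      show "\<phi> k = u * G" using A by (simp add: \<phi>_def)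
      show "\<phi> (k + j) + \<phi> (k - j) = \<phi> k * C j" if "1 \<le> j" "j < m" for j
        using reflect[OF that] that m by (simp add: \<phi>_def add.commute)
      \<comment> \<open>The index \<open>A + (k - i)\<close> lies one block above that of \<open>t i\<close>, so the residue is reversed once more.\<close>
      show "u dvd \<phi> i - smult (-1) (t i)" if "i < k" for i
      proof -
        have "A + k - i = Suc k * Suc n + (k - i)" "Suc k - (k - i) = Suc i"
          using that by (auto simp: A_def)
        then show ?thesis
          using cheb_cong_mod[of "k - i" k Y "Suc n"] that
          by (auto simp: u_def t_def \<phi>_def minus_one_power_iff simp del: cheb.simps)
      qed
      show "coeff (smult (-1) (t i)) j = 0" if "i < k" "j \<ge> k" for i j
        using t_deg[OF that] by simp
      show "coeff (\<phi> i) j = 0" if "i < k + m" "j \<ge> k + (m + N)" for i j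
        unfolding Y_def \<phi>_def by (rule coeff_cheb_eq_0) (use that in \<open>simp add: AN\<close>)
    qed
    also have "det (coeff_mat k (\<lambda>i. smult (-1) (t i))) = (-1) ^ k * (-1) ^ ((Suc k choose 2) * n)"
      by (simp only: det_coeff_mat_smult_rows det_t)
    finally have "det (mat N N (\<lambda>(i, j). Cat (\<lambda>_. c) (i + j + m) k))
      = (-1) ^ (N * (k + m) + (k + m choose 2) + k + (Suc k choose 2) * n + Suc k * n * m) * \<Gamma> ^ m"
      unfolding det_Cat_eq_det_coeff_mat u_def[symmetric] Y_def[symmetric]
      by (simp only: G0 power_mult_distrib power_mult[symmetric] power_add mult.assoc)
    also have "(-1::'a) ^ (N * (k + m) + (k + m choose 2) + k + (Suc k choose 2) * n + Suc k * n * m)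
       = (-1) ^ ((Suc k choose 2) * n + (Suc k - m choose 2))"
    proof -
      obtain p where p: "m = Suc p" using m(1) by (cases m) auto
      obtain s where s: "k = p + s" using m(2) unfolding p by (metis add_le_cancel_right le_iff_add Suc_eq_plus1)
      \<comment> \<open>The product \<open>s (k + m)\<close> is even, because \<open>s = k + 1 - m\<close> and \<open>k + m\<close> add up to \<open>2 k + 1\<close>.\<close>
      have "N = Suc k * n + s" using N by (simp add: p s)
      then have "even (N * (k + m) + Suc k * n * m)"
        by (auto simp: p s)
      moreover have "even ((k + m choose 2) + k + (Suc k - m choose 2))"
      proof -
        have "Suc x choose 2 = x + (x choose 2)" for x by (simp add: numeral_2_eq_2)
        then show ?thesis unfolding p s by (induction p) auto
      qed
      ultimately show ?thesis by (auto simp: minus_one_power_iff)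
    qed
    finally show ?thesis .
  qed
qed

theorem theorem1p4:
  fixes k m n r N :: nat
  assumes "1 \<le> m" and "m \<le> k + 1"
    and "N = (k + 1) * n + r" and "r \<le> k"
  shows "(r = 0 \<longrightarrow>
            to_fract (det (mat N N (\<lambda>(i, j). Cat_bc 0 indet (i + j + m) k)))
              = (-1) ^ (((k + 1) choose 2) * n)
                * (to_fract (F ((k + 1) * (n + 1))) / to_fract (F (k + 1))) ^ m)
       \<and> (r = k + 1 - m \<longrightarrow>
            to_fract (det (mat N N (\<lambda>(i, j). Cat_bc 0 indet (i + j + m) k)))
              = (-1) ^ (((k + 1) choose 2) * n + ((k + 1 - m) choose 2))
                * (to_fract (F ((k + 1) * (n + 1))) / to_fract (F (k + 1))) ^ m)"
proof -
  define \<Gamma> where "\<Gamma> = cheb (cheb indet (Suc (Suc k)) - cheb indet k) (Suc n)"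
  have "F (k + 1) \<noteq> 0"
    using monic_cheb[of "0::int" k] by (auto simp: F_eq_cheb monic_of_degree_def simp del: cheb.simps)
  moreover have "F ((k + 1) * (n + 1)) = F (k + 1) * \<Gamma>"
    using cheb_mult[of indet k "Suc n"] by (simp only: F_eq_cheb \<Gamma>_def Suc_eq_plus1)
  ultimately have ratio: "to_fract (F ((k + 1) * (n + 1))) / to_fract (F (k + 1)) = to_fract \<Gamma>"
    by simp
  have sign: "to_fract ((-1) ^ e * \<Gamma> ^ m) = (-1) ^ e * to_fract \<Gamma> ^ m" for e
  proof -
    have "to_fract (\<Gamma> ^ m) = to_fract \<Gamma> ^ m" by (induction m) auto
    then show ?thesis by (simp add: minus_one_power_iff)
  qed
  have Cat: "Cat_bc 0 indet a k = Cat (\<lambda>_. indet) a k" for a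
    by (simp add: Cat_bc_def cong: if_cong)
  show ?thesis
    unfolding ratio Cat
  proof (intro conjI impI)
    assume "r = 0"
    then have N: "N = Suc k * n" using assms(3) by simp
    show "to_fract (det (mat N N (\<lambda>(i, j). Cat (\<lambda>_. indet) (i + j + m) k)))
      = (-1) ^ ((k + 1 choose 2) * n) * to_fract \<Gamma> ^ m"
      using det_Cat_full_blocks[OF assms(1,2), of n indet, folded \<Gamma>_def, folded N]
      by (simp flip: sign)
  next
    assume "r = k + 1 - m"
    then have "N + m = Suc k * Suc n" using assms by simp
    from det_Cat_partial_block[OF assms(1,2) this, of indet, folded \<Gamma>_def]
    show "to_fract (det (mat N N (\<lambda>(i, j). Cat (\<lambda>_. indet) (i + j + m) k)))
      = (-1) ^ ((k + 1 choose 2) * n + (k + 1 - m choose 2)) * to_fract \<Gamma> ^ m"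
      by (simp flip: sign)
  qed
qed

end
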